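(* Let $\mathcal C$ be a balanced factorization category such that for every object $X$ of $\mathcal C$ all discrete fibrations and all discrete opfibrations over $X$ are exponentiable objects of $\mathcal C/X$. Let $X$ be an object of $\mathcal C$. If $m\in\mathcal M/X$ and $n\in\mathcal M'/X$, then the exponential $m^n$ in $\mathcal C/X$ is in $\mathcal M/X$ and, dually, the exponential $n^m$ in $\mathcal C/X$ is in $\mathcal M'/X$.
   Context: A balanced factorization category is a finitely complete category $\mathcal C$ with two (orthogonal) factorization systems $(\mathcal E,\mathcal M)$ and $(\mathcal E',\mathcal M')$ such that $\mathcal M/1=\mathcal M'/1$ (an object $S$ has $S\to 1$ in $\mathcal M$ iff in $\mathcal M'$), and such that the pullback of a map in $\mathcal E$ along a map in $\mathcal M'$ is in $\mathcal E$, and the pullback of a map in $\mathcal E'$ along a map in $\mathcal M$ is in $\mathcal E'$. Maps in $\mathcal M$ are called discrete fibrations and maps in $\mathcal M'$ discrete opfibrations. $\mathcal M/X$ (resp. $\mathcal M'/X$) is the full subcategory of $\mathcal C/X$ on the objects $A\to X$ that are in $\mathcal M$ (resp. $\mathcal M'$). An object $n$ of $\mathcal C/X$ is exponentiable if the functor $n\times-:\mathcal C/X\to\mathcal C/X$ (product in $\mathcal C/X$, i.e. pullback over $X$) has a right adjoint, denoted $(-)^n$. *)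

theory Defs
  imports Main
begin

record ('o, 'm) cat =
  Obj :: "'o set"
  Mor :: "'m set"
  Src :: "'m \<Rightarrow> 'o"
  Tgt :: "'m \<Rightarrow> 'o"
  Idn :: "'o \<Rightarrow> 'm"
  Cmp :: "'m \<Rightarrow> 'm \<Rightarrow> 'm"  (infixl "\<cdot>\<index>" 70)

definition hom :: "('o, 'm) cat \<Rightarrow> 'o \<Rightarrow> 'o \<Rightarrow> 'm set" where
  "hom C A B = {f \<in> Mor C. Src C f = A \<and> Tgt C f = B}"

text \<open>Composition is in applicative order; only its values on composable pairs matter.\<close>

locale category =
  fixes C :: "('o, 'm) cat" (structure)
  assumes src_obj: "f \<in> Mor C \<Longrightarrow> Src C f \<in> Obj C"
    and tgt_obj: "f \<in> Mor C \<Longrightarrow> Tgt C f \<in> Obj C"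
    and idn_hom: "A \<in> Obj C \<Longrightarrow> Idn C A \<in> hom C A A"
    and cmp_hom: "f \<in> hom C A B \<Longrightarrow> g \<in> hom C B D \<Longrightarrow> g \<cdot> f \<in> hom C A D"
    and cmp_idn_left: "f \<in> hom C A B \<Longrightarrow> Idn C B \<cdot> f = f"
    and cmp_idn_right: "f \<in> hom C A B \<Longrightarrow> f \<cdot> Idn C A = f"
    and cmp_assoc: "f \<in> hom C A B \<Longrightarrow> g \<in> hom C B D \<Longrightarrow> h \<in> hom C D D'
      \<Longrightarrow> h \<cdot> (g \<cdot> f) = (h \<cdot> g) \<cdot> f"

record ('o1, 'm1, 'o2, 'm2) func =
  omap :: "'o1 \<Rightarrow> 'o2"
  mmap :: "'m1 \<Rightarrow> 'm2"

definition is_functor ::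
  "('o1, 'm1) cat \<Rightarrow> ('o2, 'm2) cat \<Rightarrow> ('o1, 'm1, 'o2, 'm2) func \<Rightarrow> bool" where
  "is_functor C D F \<longleftrightarrow>
     (\<forall>A\<in>Obj C. omap F A \<in> Obj D) \<and>
     (\<forall>f\<in>Mor C. mmap F f \<in> hom D (omap F (Src C f)) (omap F (Tgt C f))) \<and>
     (\<forall>A\<in>Obj C. mmap F (Idn C A) = Idn D (omap F A)) \<and>
     (\<forall>f\<in>Mor C. \<forall>g\<in>Mor C. Tgt C f = Src C g \<longrightarrow>
        mmap F (g \<cdot>\<^bsub>C\<^esub> f) = mmap F g \<cdot>\<^bsub>D\<^esub> mmap F f)"

text \<open>The functor \<open>G : D \<rightarrow> C\<close> is right adjoint to \<open>F : C \<rightarrow> D\<close>: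
  bijections \<open>D(F A, B) \<cong> C(A, G B)\<close>, natural in \<open>A\<close> and \<open>B\<close>.\<close>

definition right_adjoint ::
  "('o1, 'm1) cat \<Rightarrow> ('o2, 'm2) cat \<Rightarrow> ('o1, 'm1, 'o2, 'm2) func
     \<Rightarrow> ('o2, 'm2, 'o1, 'm1) func \<Rightarrow> bool" where
  "right_adjoint C D F G \<longleftrightarrow> is_functor C D F \<and> is_functor D C G \<and>
     (\<exists>\<phi>.
       (\<forall>A\<in>Obj C. \<forall>B\<in>Obj D.
          bij_betw (\<phi> A B) (hom D (omap F A) B) (hom C A (omap G B))) \<and>
       (\<forall>a\<in>Mor C. \<forall>b\<in>Mor D. \<forall>f\<in>hom D (omap F (Tgt C a)) (Src D b).
          \<phi> (Src C a) (Tgt D b) (b \<cdot>\<^bsub>D\<^esub> f \<cdot>\<^bsub>D\<^esub> mmap F a)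
            = mmap G b \<cdot>\<^bsub>C\<^esub> \<phi> (Tgt C a) (Src D b) f \<cdot>\<^bsub>C\<^esub> a))"

definition full_sub :: "('o, 'm) cat \<Rightarrow> 'o set \<Rightarrow> ('o, 'm) cat" where
  "full_sub C S = C\<lparr>Obj := Obj C \<inter> S, Mor := {f \<in> Mor C. Src C f \<in> S \<and> Tgt C f \<in> S}\<rparr>"

text \<open>Slice category: the triple \<open>(f, h, g)\<close> is the map \<open>h\<close> regarded as a map from
  \<open>f\<close> to \<open>g\<close> over \<open>X\<close>.\<close>

definition slice :: "('o, 'm) cat \<Rightarrow> 'o \<Rightarrow> ('m, 'm \<times> 'm \<times> 'm) cat" where
  "slice C X = \<lparr>
     Obj = {f \<in> Mor C. Tgt C f = X},
     Mor = {(f, h, g). f \<in> Mor C \<and> Tgt C f = X \<and> g \<in> Mor C \<and> Tgt C g = X \<and>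
                       h \<in> hom C (Src C f) (Src C g) \<and> g \<cdot>\<^bsub>C\<^esub> h = f},
     Src = (\<lambda>(f, h, g). f),
     Tgt = (\<lambda>(f, h, g). g),
     Idn = (\<lambda>f. (f, Idn C (Src C f), f)),
     Cmp = (\<lambda>(f', h', g') (f, h, g). (f, h' \<cdot>\<^bsub>C\<^esub> h, g'))\<rparr>"

definition slice_of :: "('o, 'm) cat \<Rightarrow> 'm set \<Rightarrow> 'o \<Rightarrow> ('m, 'm \<times> 'm \<times> 'm) cat" where
  "slice_of C M X = full_sub (slice C X) M"

definition is_terminal :: "('o, 'm) cat \<Rightarrow> 'o \<Rightarrow> bool" where
  "is_terminal C T \<longleftrightarrow> T \<in> Obj C \<and> (\<forall>A\<in>Obj C. \<exists>!f. f \<in> hom C A T)"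

definition is_product :: "('o, 'm) cat \<Rightarrow> 'o \<Rightarrow> 'o \<Rightarrow> 'o \<Rightarrow> 'm \<Rightarrow> 'm \<Rightarrow> bool" where
  "is_product C A B P p q \<longleftrightarrow>
     P \<in> Obj C \<and> p \<in> hom C P A \<and> q \<in> hom C P B \<and>
     (\<forall>Z\<in>Obj C. \<forall>a\<in>hom C Z A. \<forall>b\<in>hom C Z B.
        \<exists>!u. u \<in> hom C Z P \<and> p \<cdot>\<^bsub>C\<^esub> u = a \<and> q \<cdot>\<^bsub>C\<^esub> u = b)"

text \<open>The square \<open>f \<cdot> p = g \<cdot> q\<close> is a pullback; thus \<open>q\<close> is a pullback of \<open>f\<close> along \<open>g\<close>.\<close>

definition is_pullback :: "('o, 'm) cat \<Rightarrow> 'm \<Rightarrow> 'm \<Rightarrow> 'm \<Rightarrow> 'm \<Rightarrow> bool" where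
  "is_pullback C f g p q \<longleftrightarrow>
     f \<in> Mor C \<and> g \<in> Mor C \<and> Tgt C f = Tgt C g \<and>
     p \<in> Mor C \<and> q \<in> Mor C \<and> Src C p = Src C q \<and>
     Tgt C p = Src C f \<and> Tgt C q = Src C g \<and> f \<cdot>\<^bsub>C\<^esub> p = g \<cdot>\<^bsub>C\<^esub> q \<and>
     (\<forall>Z\<in>Obj C. \<forall>a\<in>hom C Z (Src C f). \<forall>b\<in>hom C Z (Src C g).
        f \<cdot>\<^bsub>C\<^esub> a = g \<cdot>\<^bsub>C\<^esub> b \<longrightarrow>
        (\<exists>!u. u \<in> hom C Z (Src C p) \<and> p \<cdot>\<^bsub>C\<^esub> u = a \<and> q \<cdot>\<^bsub>C\<^esub> u = b))"

definition is_cone ::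
  "('i, 'j) cat \<Rightarrow> ('o, 'm) cat \<Rightarrow> ('i, 'j, 'o, 'm) func \<Rightarrow> 'o \<Rightarrow> ('i \<Rightarrow> 'm) \<Rightarrow> bool" where
  "is_cone J C F L \<pi> \<longleftrightarrow> L \<in> Obj C \<and>
     (\<forall>i\<in>Obj J. \<pi> i \<in> hom C L (omap F i)) \<and>
     (\<forall>f\<in>Mor J. mmap F f \<cdot>\<^bsub>C\<^esub> \<pi> (Src J f) = \<pi> (Tgt J f))"

definition is_limit ::
  "('i, 'j) cat \<Rightarrow> ('o, 'm) cat \<Rightarrow> ('i, 'j, 'o, 'm) func \<Rightarrow> 'o \<Rightarrow> ('i \<Rightarrow> 'm) \<Rightarrow> bool" where
  "is_limit J C F L \<pi> \<longleftrightarrow> is_cone J C F L \<pi> \<and>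
     (\<forall>Z \<sigma>. is_cone J C F Z \<sigma> \<longrightarrow>
        (\<exists>!u. u \<in> hom C Z L \<and> (\<forall>i\<in>Obj J. \<pi> i \<cdot>\<^bsub>C\<^esub> u = \<sigma> i)))"

text \<open>Indexing by finite categories with objects and maps in \<^typ>\<open>nat\<close> loses no generality,
  as every finite category is isomorphic to one of these.\<close>

definition finitely_complete :: "('o, 'm) cat \<Rightarrow> bool" where
  "finitely_complete C \<longleftrightarrow>
     (\<forall>(J :: (nat, nat) cat) F.
        category J \<and> finite (Obj J) \<and> finite (Mor J) \<and> is_functor J C F \<longrightarrow>
        (\<exists>L \<pi>. is_limit J C F L \<pi>))"

definition orthogonal :: "('o, 'm) cat \<Rightarrow> 'm \<Rightarrow> 'm \<Rightarrow> bool" where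
  "orthogonal C e m \<longleftrightarrow>
     (\<forall>u\<in>hom C (Src C e) (Src C m). \<forall>v\<in>hom C (Tgt C e) (Tgt C m).
        m \<cdot>\<^bsub>C\<^esub> u = v \<cdot>\<^bsub>C\<^esub> e \<longrightarrow>
        (\<exists>!d. d \<in> hom C (Tgt C e) (Src C m) \<and> d \<cdot>\<^bsub>C\<^esub> e = u \<and> m \<cdot>\<^bsub>C\<^esub> d = v))"

definition factorization_system :: "('o, 'm) cat \<Rightarrow> 'm set \<Rightarrow> 'm set \<Rightarrow> bool" where
  "factorization_system C E M \<longleftrightarrow>
     E = {e \<in> Mor C. \<forall>m\<in>M. orthogonal C e m} \<and>
     M = {m \<in> Mor C. \<forall>e\<in>E. orthogonal C e m} \<and>
     (\<forall>f\<in>Mor C. \<exists>e\<in>E. \<exists>m\<in>M. Tgt C e = Src C m \<and> f = m \<cdot>\<^bsub>C\<^esub> e)"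

locale balanced_factorization_category = category C
  for C :: "('o, 'm) cat" (structure) +
  fixes E M E' M' :: "'m set"
  assumes finitely_complete: "finitely_complete C"
    and factorization: "factorization_system C E M"
    and factorization': "factorization_system C E' M'"
    and slices_terminal: "is_terminal C T \<Longrightarrow> slice_of C M T = slice_of C M' T"
    and pullback_E: "e \<in> E \<Longrightarrow> n \<in> M' \<Longrightarrow> is_pullback C e n p q \<Longrightarrow> q \<in> E"
    and pullback_E': "e \<in> E' \<Longrightarrow> m \<in> M \<Longrightarrow> is_pullback C e m p q \<Longrightarrow> q \<in> E'"

text \<open>The functor \<open>F\<close> is \<open>n \<times> -\<close> for a choice of products with projections \<open>p\<close> and \<open>q\<close>.\<close>

definition is_product_functor ::
  "('o, 'm) cat \<Rightarrow> 'o \<Rightarrow> ('o, 'm, 'o, 'm) func \<Rightarrow> ('o \<Rightarrow> 'm) \<Rightarrow> ('o \<Rightarrow> 'm) \<Rightarrow> bool" where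
  "is_product_functor C n F p q \<longleftrightarrow> is_functor C C F \<and>
     (\<forall>B\<in>Obj C. is_product C n B (omap F B) (p B) (q B)) \<and>
     (\<forall>f\<in>Mor C. p (Tgt C f) \<cdot>\<^bsub>C\<^esub> mmap F f = p (Src C f) \<and>
                q (Tgt C f) \<cdot>\<^bsub>C\<^esub> mmap F f = f \<cdot>\<^bsub>C\<^esub> q (Src C f))"

definition exponentiable :: "('o, 'm) cat \<Rightarrow> 'o \<Rightarrow> bool" where
  "exponentiable C n \<longleftrightarrow> n \<in> Obj C \<and>
     (\<exists>F p q G. is_product_functor C n F p q \<and> right_adjoint C C F G)"

text \<open>The object \<open>e\<close> is an exponential \<open>m\<^sup>n\<close>. It depends on the choice of \<open>n \<times> -\<close> and of its
  right adjoint, so exponentials are given by a predicate; they are unique up to isomorphism.\<close>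

definition is_exponential :: "('o, 'm) cat \<Rightarrow> 'o \<Rightarrow> 'o \<Rightarrow> 'o \<Rightarrow> bool" where
  "is_exponential C m n e \<longleftrightarrow> n \<in> Obj C \<and> m \<in> Obj C \<and>
     (\<exists>F p q G. is_product_functor C n F p q \<and> right_adjoint C C F G \<and> e = omap G m)"

lemma exponential_exists:
  assumes "exponentiable C n" "m \<in> Obj C"
  shows "\<exists>e. is_exponential C m n e"
  using assms unfolding exponentiable_def is_exponential_def by blast

lemma (in category) category_slice: "category (slice C X)"
proof
  show "Idn (slice C X) A \<in> hom (slice C X) A A" if "A \<in> Obj (slice C X)" for A
    using that idn_hom[of "Src C A"] cmp_idn_right[of A "Src C A" "Tgt C A"] src_obj[of A]
    by (auto simp: slice_def hom_def)
  show "g \<cdot>\<^bsub>slice C X\<^esub> f \<in> hom (slice C X) A D"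
    if fg: "f \<in> hom (slice C X) A B" "g \<in> hom (slice C X) B D" for f g A B D
  proof -
    obtain f' g' where "f = (A, f', B)" "g = (B, g', D)"
      using fg by (cases f; cases g) (simp add: slice_def hom_def)
    moreover from this fg have "f' \<in> hom C (Src C A) (Src C B)"
      "g' \<in> hom C (Src C B) (Src C D)" "D \<in> hom C (Src C D) X"
      by (auto simp: slice_def hom_def)
    ultimately show ?thesis
      using fg cmp_hom[of f' "Src C A" "Src C B" g' "Src C D"]
        cmp_assoc[of f' "Src C A" "Src C B" g' "Src C D" D X]
      by (auto simp: slice_def hom_def)
  qed
  show "h \<cdot>\<^bsub>slice C X\<^esub> (g \<cdot>\<^bsub>slice C X\<^esub> f) = (h \<cdot>\<^bsub>slice C X\<^esub> g) \<cdot>\<^bsub>slice C X\<^esub> f"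
    if "f \<in> hom (slice C X) A B" "g \<in> hom (slice C X) B D" "h \<in> hom (slice C X) D D'"
    for f g h A B D D'
    using that by (auto simp: slice_def hom_def cmp_assoc)
qed (auto simp: slice_def hom_def cmp_idn_left cmp_idn_right)

lemma category_full_sub: "category C \<Longrightarrow> category (full_sub C S)"
  unfolding category_def full_sub_def hom_def by auto

end

theory Submission
  imports Defs
begin

text \<open>A map is orthogonal to \<open>m\<close> iff precomposition with it, over every base map, is bijective on
  maps into \<open>m\<close> in the slice. Let \<open>e \<in> E\<close> and regard it as a map of \<open>\<C>/X\<close>. Then \<open>n \<times> e\<close>, the
  pullback of \<open>e\<close> along a pullback of \<open>n \<in> M'\<close>, is again in \<open>E\<close>, hence orthogonal to \<open>m \<in> M\<close>.
  The adjunction carries this bijectivity for \<open>n \<times> e\<close> and \<open>m\<close> to that for \<open>e\<close> and \<open>m\<^sup>n\<close>, so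
  \<open>m\<^sup>n\<close> is orthogonal to \<open>E\<close>. The other half is the same argument with the two systems exchanged.\<close>

text \<open>Naturality in the first argument gives a commuting square: \<open>\<phi>\<close> turns
  precomposition with \<open>mmap F a\<close> into precomposition with \<open>a\<close>. Both
  instances of \<open>\<phi>\<close> in that square are bijections, so bijectivity passes from one
  precomposition to the other.\<close>

lemma right_adjoint_precomp_bij:
  assumes cat: "category C" "category D" and adj: "right_adjoint C D F G"
    and a: "a \<in> hom C A A'" and B: "B \<in> Obj D"
    and bij: "bij_betw (\<lambda>g. g \<cdot>\<^bsub>D\<^esub> mmap F a) (hom D (omap F A') B) (hom D (omap F A) B)"
  shows "bij_betw (\<lambda>d. d \<cdot>\<^bsub>C\<^esub> a) (hom C A' (omap G B)) (hom C A (omap G B))"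
proof -
  interpret C: category C by fact
  interpret D: category D by fact
  obtain \<phi> where
    \<phi>: "\<And>A B. A \<in> Obj C \<Longrightarrow> B \<in> Obj D \<Longrightarrow>
          bij_betw (\<phi> A B) (hom D (omap F A) B) (hom C A (omap G B))"
    and nat: "\<And>a b f. a \<in> Mor C \<Longrightarrow> b \<in> Mor D \<Longrightarrow> f \<in> hom D (omap F (Tgt C a)) (Src D b) \<Longrightarrow>
          \<phi> (Src C a) (Tgt D b) (b \<cdot>\<^bsub>D\<^esub> f \<cdot>\<^bsub>D\<^esub> mmap F a)
            = mmap G b \<cdot>\<^bsub>C\<^esub> \<phi> (Tgt C a) (Src D b) f \<cdot>\<^bsub>C\<^esub> a"
    and G: "is_functor D C G"
    using adj unfolding right_adjoint_def by blast
  have a': "a \<in> Mor C" "Src C a = A" "Tgt C a = A'" using a by (auto simp: hom_def)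
  have AA: "A \<in> Obj C" "A' \<in> Obj C" using a' C.src_obj C.tgt_obj by auto
  \<comment> \<open>The assumed naturality is joint in both variables. Taking \<open>b\<close> to be
    the identity of \<open>B\<close>, which \<open>G\<close> preserves, leaves naturality in the
    first variable.\<close>
  have nat1: "\<phi> A B (g \<cdot>\<^bsub>D\<^esub> mmap F a) = \<phi> A' B g \<cdot>\<^bsub>C\<^esub> a" if g: "g \<in> hom D (omap F A') B" for g
  proof -
    have i: "Idn D B \<in> Mor D" "Src D (Idn D B) = B" "Tgt D (Idn D B) = B"
      using D.idn_hom[OF B] by (auto simp: hom_def)
    have "mmap G (Idn D B) = Idn C (omap G B)" using G B by (auto simp: is_functor_def)
    moreover have "\<phi> A' B g \<in> hom C A' (omap G B)"
      using \<phi>[OF AA(2) B] g by (rule bij_betwE[THEN bspec])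
    ultimately show ?thesis
      using nat[OF a'(1) i(1), of g] g a' i D.cmp_idn_left[OF g] C.cmp_idn_left by simp
  qed
  have "bij_betw (\<lambda>g. \<phi> A B (g \<cdot>\<^bsub>D\<^esub> mmap F a)) (hom D (omap F A') B) (hom C A (omap G B))"
    using bij_betw_trans[OF bij \<phi>[OF AA(1) B]] by (simp add: comp_def)
  then have "bij_betw ((\<lambda>d. d \<cdot>\<^bsub>C\<^esub> a) \<circ> \<phi> A' B) (hom D (omap F A') B) (hom C A (omap G B))"
    by (rule bij_betw_cong[THEN iffD1, rotated]) (simp add: nat1)
  then show ?thesis
    using bij_betw_comp_iff[OF \<phi>[OF AA(2) B]] by blast
qed

section \<open>Orthogonality expressed in the slices\<close>

context category
begin

lemma hom_slice:
  "hom (slice C X) f g = {(f, h, g) | h. f \<in> hom C (Src C f) X \<and> g \<in> hom C (Src C g) X \<and>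
     h \<in> hom C (Src C f) (Src C g) \<and> g \<cdot> h = f}"
  by (auto simp: slice_def hom_def)

lemma Cmp_slice: "(f', h', g') \<cdot>\<^bsub>slice C X\<^esub> (f, h, g) = (f, h' \<cdot> h, g')"
  by (simp add: slice_def)

text \<open>A slice map from \<open>v\<close> to \<open>m\<close> is a solution \<open>d\<close> of
  the lower triangle of a lifting problem with bottom edge \<open>v\<close>, and a slice map from
  \<open>v \<cdot> e\<close> to \<open>m\<close> is a top edge of such a problem. Bijectivity
  therefore says that each top edge has exactly one diagonal.\<close>

lemma slice_precomp_bij_iff:
  assumes e: "e \<in> hom C A B" and v: "v \<in> hom C B X" and m: "m \<in> hom C S X"
  shows "bij_betw (\<lambda>d. d \<cdot>\<^bsub>slice C X\<^esub> (v \<cdot> e, e, v)) (hom (slice C X) v m) (hom (slice C X) (v \<cdot> e) m)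
    \<longleftrightarrow> (\<forall>u\<in>hom C A S. m \<cdot> u = v \<cdot> e \<longrightarrow>
           (\<exists>!d. d \<in> hom C B S \<and> d \<cdot> e = u \<and> m \<cdot> d = v))"
    (is "?L \<longleftrightarrow> ?R")
proof -
  have ve: "v \<cdot> e \<in> hom C A X" using e v by (rule cmp_hom)
  have src: "Src C v = B" "Src C m = S" "Src C (v \<cdot> e) = A"
    using v m ve by (auto simp: hom_def)
  \<comment> \<open>\<open>H\<close> and \<open>K\<close> are the two hom sets of the slice stripped
    of source and target tags. Tagging is injective, so bijectivity can be tested on the underlying
    maps.\<close>
  define H K where "H = {d \<in> hom C B S. m \<cdot> d = v}" and "K = {u \<in> hom C A S. m \<cdot> u = v \<cdot> e}"
  have dom: "hom (slice C X) v m = (\<lambda>d. (v, d, m)) ` H"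
    and cod: "hom (slice C X) (v \<cdot> e) m = (\<lambda>u. (v \<cdot> e, u, m)) ` K"
    unfolding hom_slice src H_def K_def using v m ve by auto
  have HK: "(\<lambda>d. d \<cdot> e) ` H \<subseteq> K"
    using e v m by (auto simp: H_def K_def intro: cmp_hom) (metis cmp_assoc)
  have "?L \<longleftrightarrow> bij_betw (\<lambda>d. d \<cdot> e) H K"
  proof -
    have "(\<lambda>d. (v \<cdot> e, d \<cdot> e, m)) ` H = (\<lambda>u. (v \<cdot> e, u, m)) ` K \<longleftrightarrow> (\<lambda>d. d \<cdot> e) ` H = K"
      using inj_image_eq_iff[of "\<lambda>u. (v \<cdot> e, u, m)" "(\<lambda>d. d \<cdot> e) ` H" K]
      by (simp add: image_image inj_on_def)
    then show ?thesis
      unfolding dom cod bij_betw_def by (simp add: Cmp_slice image_image inj_on_def)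
  qed
  also have "\<dots> \<longleftrightarrow> (\<forall>u\<in>K. \<exists>!d. d \<in> H \<and> d \<cdot> e = u)"
    using HK unfolding bij_betw_def inj_on_def set_eq_subset by blast
  also have "\<dots> \<longleftrightarrow> ?R" unfolding H_def K_def mem_Collect_eq by blast
  finally show ?thesis .
qed

text \<open>Letting the bottom edge \<open>v\<close> vary gives full orthogonality. This form
  concerns hom sets of the slice only, where the adjunction defining exponentials can act on
  it.\<close>

lemma orthogonal_iff_slice_bij:
  assumes e: "e \<in> hom C A B" and m: "m \<in> hom C S X"
  shows "orthogonal C e m \<longleftrightarrow> (\<forall>v\<in>hom C B X.
    bij_betw (\<lambda>d. d \<cdot>\<^bsub>slice C X\<^esub> (v \<cdot> e, e, v)) (hom (slice C X) v m) (hom (slice C X) (v \<cdot> e) m))"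
proof -
  have "Src C e = A" "Tgt C e = B" "Src C m = S" "Tgt C m = X" using e m by (auto simp: hom_def)
  then have "orthogonal C e m \<longleftrightarrow> (\<forall>v\<in>hom C B X. \<forall>u\<in>hom C A S. m \<cdot> u = v \<cdot> e \<longrightarrow>
      (\<exists>!d. d \<in> hom C B S \<and> d \<cdot> e = u \<and> m \<cdot> d = v))"
    unfolding orthogonal_def by (simp only:) blast
  then show ?thesis by (simp add: slice_precomp_bij_iff[OF e _ m])
qed

section \<open>Pullbacks: products in slices, stability of right classes, pasting\<close>

lemma is_pullbackI:
  assumes "f \<in> hom C A S" "g \<in> hom C B S" "p \<in> hom C P A" "q \<in> hom C P B" "f \<cdot> p = g \<cdot> q"
    and "\<And>Z a b. a \<in> hom C Z A \<Longrightarrow> b \<in> hom C Z B \<Longrightarrow> f \<cdot> a = g \<cdot> b \<Longrightarrow>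
      \<exists>!u. u \<in> hom C Z P \<and> p \<cdot> u = a \<and> q \<cdot> u = b"
  shows "is_pullback C f g p q"
proof -
  have "f \<in> Mor C" "g \<in> Mor C" "p \<in> Mor C" "q \<in> Mor C" "Src C f = A" "Src C g = B"
    "Src C p = P" "Src C q = P" "Tgt C f = S" "Tgt C g = S" "Tgt C p = A" "Tgt C q = B"
    using assms(1-4) by (auto simp: hom_def)
  then show ?thesis using assms(5,6) by (simp add: is_pullback_def)
qed

lemma pullback_universal:
  assumes "is_pullback C f g p q"
    and a: "a \<in> hom C Z (Src C f)" and b: "b \<in> hom C Z (Src C g)" and "f \<cdot> a = g \<cdot> b"
  shows "\<exists>!u. u \<in> hom C Z (Src C p) \<and> p \<cdot> u = a \<and> q \<cdot> u = b"
proof -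
  have "Z \<in> Obj C" using a src_obj by (auto simp: hom_def)
  with assms show ?thesis unfolding is_pullback_def by blast
qed

text \<open>This links the product functor on the slice, on which exponentials depend, with the
  pullbacks of \<open>C\<close>, to which the stability of the left classes refers.\<close>

lemma slice_product_pullback:
  assumes "is_product (slice C X) f g P p q"
  obtains p' q' where "p = (P, p', f)" "q = (P, q', g)" "f \<cdot> p' = P" "g \<cdot> q' = P"
    "p' \<in> hom C (Src C P) (Src C f)" "q' \<in> hom C (Src C P) (Src C g)"
    "is_pullback C f g p' q'"
proof -
  have p: "p \<in> hom (slice C X) P f" and q: "q \<in> hom (slice C X) P g"
    and uni: "\<And>Z a b. Z \<in> Obj (slice C X) \<Longrightarrow> a \<in> hom (slice C X) Z f \<Longrightarrow> b \<in> hom (slice C X) Z g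
      \<Longrightarrow> \<exists>!u. u \<in> hom (slice C X) Z P \<and> p \<cdot>\<^bsub>slice C X\<^esub> u = a \<and> q \<cdot>\<^bsub>slice C X\<^esub> u = b"
    using assms by (auto simp: is_product_def)
  obtain p' q' where
    pq: "p = (P, p', f)" "q = (P, q', g)" "f \<cdot> p' = P" "g \<cdot> q' = P"
      "p' \<in> hom C (Src C P) (Src C f)" "q' \<in> hom C (Src C P) (Src C g)"
      "f \<in> hom C (Src C f) X" "g \<in> hom C (Src C g) X" "P \<in> hom C (Src C P) X"
    using p q unfolding hom_slice by auto
  have "\<exists>!u. u \<in> hom C Z (Src C P) \<and> p' \<cdot> u = a \<and> q' \<cdot> u = b"
    if a: "a \<in> hom C Z (Src C f)" and b: "b \<in> hom C Z (Src C g)" and ab: "f \<cdot> a = g \<cdot> b" for Z a b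
  proof -
    \<comment> \<open>The common composite makes \<open>Z\<close> an object over \<open>X\<close>,
      so that \<open>a\<close> and \<open>b\<close> become slice maps and the product property
      applies.\<close>
    let ?z = "f \<cdot> a"
    have z: "?z \<in> hom C Z X" using a pq(7) by (rule cmp_hom)
    then have zs: "Src C ?z = Z" by (simp add: hom_def)
    have zo: "?z \<in> Obj (slice C X)" using z by (simp add: slice_def hom_def)
    have ex1: "\<exists>!u. u \<in> hom (slice C X) ?z P \<and> p \<cdot>\<^bsub>slice C X\<^esub> u = (?z, a, f)
        \<and> q \<cdot>\<^bsub>slice C X\<^esub> u = (?z, b, g)"
      by (rule uni[OF zo]) (use a b ab z zs pq in \<open>auto simp: hom_slice\<close>)
    \<comment> \<open>Compatibility of \<open>u\<close> with the maps to \<open>X\<close> is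
      automatic: \<open>P\<close> is \<open>f \<cdot> p'\<close>, so \<open>p' \<cdot> u = a\<close>
      already forces \<open>P \<cdot> u = ?z\<close>.\<close>
    have iff: "(?z, u, P) \<in> hom (slice C X) ?z P \<and> p \<cdot>\<^bsub>slice C X\<^esub> (?z, u, P) = (?z, a, f)
        \<and> q \<cdot>\<^bsub>slice C X\<^esub> (?z, u, P) = (?z, b, g) \<longleftrightarrow>
        u \<in> hom C Z (Src C P) \<and> p' \<cdot> u = a \<and> q' \<cdot> u = b" for u
    proof -
      have "P \<cdot> u = ?z" if "u \<in> hom C Z (Src C P)" "p' \<cdot> u = a"
        using cmp_assoc[OF that(1) pq(5) pq(7)] that(2) pq(3) by simp
      then show ?thesis
        using z zs pq by (auto simp: hom_slice Cmp_slice)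
    qed
    from ex1 obtain t where t: "t \<in> hom (slice C X) ?z P" "p \<cdot>\<^bsub>slice C X\<^esub> t = (?z, a, f)"
        "q \<cdot>\<^bsub>slice C X\<^esub> t = (?z, b, g)" by blast
    then obtain u where u: "t = (?z, u, P)" unfolding hom_slice by auto
    show ?thesis
    proof (rule ex1I[of _ u])
      show "u \<in> hom C Z (Src C P) \<and> p' \<cdot> u = a \<and> q' \<cdot> u = b"
        using t u iff by blast
      show "w = u" if "w \<in> hom C Z (Src C P) \<and> p' \<cdot> w = a \<and> q' \<cdot> w = b" for w
        using ex1 t u that iff[of w] by (metis prod.inject)
    qed
  qed
  then have "is_pullback C f g p' q'"
    using pq by (intro is_pullbackI[OF pq(7,8,5,6)]) auto
  with pq that show ?thesis by blast
qed

text \<open>A square from \<open>e\<close> to \<open>q\<close>, pasted with the pullback square, is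
  a square from \<open>e\<close> to \<open>f\<close>. Its diagonal \<open>k\<close> and the bottom
  edge \<open>v\<close> form a cone, and the induced map \<open>d\<close> is the diagonal
  sought.\<close>

lemma pullback_orthogonal:
  assumes pb: "is_pullback C f g p q" and e: "e \<in> Mor C" and orth: "orthogonal C e f"
  shows "orthogonal C e q"
  unfolding orthogonal_def
proof (intro ballI impI)
  fix u v
  assume u: "u \<in> hom C (Src C e) (Src C q)" and v: "v \<in> hom C (Tgt C e) (Tgt C q)"
    and sq: "q \<cdot> u = v \<cdot> e"
  have p: "p \<in> hom C (Src C q) (Src C f)" and q: "q \<in> hom C (Src C q) (Tgt C q)"
    and g: "g \<in> hom C (Tgt C q) (Tgt C f)" and f: "f \<in> hom C (Src C f) (Tgt C f)"
    and com: "f \<cdot> p = g \<cdot> q"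
    using pb by (auto simp: is_pullback_def hom_def)
  have uni: "\<exists>!u. u \<in> hom C Z (Src C q) \<and> p \<cdot> u = a \<and> q \<cdot> u = b"
    if "a \<in> hom C Z (Src C f)" "b \<in> hom C Z (Tgt C q)" "f \<cdot> a = g \<cdot> b" for Z a b
    using pullback_universal[OF pb, of a Z b] that pb by (simp add: is_pullback_def)
  have e': "e \<in> hom C (Src C e) (Tgt C e)" using e by (simp add: hom_def)
  have pu: "p \<cdot> u \<in> hom C (Src C e) (Src C f)" and gv: "g \<cdot> v \<in> hom C (Tgt C e) (Tgt C f)"
    using u p v g cmp_hom by blast+
  have fpu: "f \<cdot> (p \<cdot> u) = (g \<cdot> v) \<cdot> e"
    using cmp_assoc[OF u p f] cmp_assoc[OF u q g] cmp_assoc[OF e' v g] com sq by simp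
  obtain k where k: "k \<in> hom C (Tgt C e) (Src C f)" "k \<cdot> e = p \<cdot> u" "f \<cdot> k = g \<cdot> v"
    and k_uniq: "\<And>l. l \<in> hom C (Tgt C e) (Src C f) \<Longrightarrow> l \<cdot> e = p \<cdot> u \<Longrightarrow> f \<cdot> l = g \<cdot> v \<Longrightarrow> l = k"
    using orth pu gv fpu unfolding orthogonal_def by metis
  obtain d where d: "d \<in> hom C (Tgt C e) (Src C q)" "p \<cdot> d = k" "q \<cdot> d = v"
    and d_uniq: "\<And>l. l \<in> hom C (Tgt C e) (Src C q) \<Longrightarrow> p \<cdot> l = k \<Longrightarrow> q \<cdot> l = v \<Longrightarrow> l = d"
    using uni[OF k(1) v k(3)] by metis
  show "\<exists>!d. d \<in> hom C (Tgt C e) (Src C q) \<and> d \<cdot> e = u \<and> q \<cdot> d = v"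
  proof (rule ex1I[of _ d])
    have de: "d \<cdot> e \<in> hom C (Src C e) (Src C q)" using e' d(1) by (rule cmp_hom)
    have "p \<cdot> (d \<cdot> e) = p \<cdot> u" "q \<cdot> (d \<cdot> e) = q \<cdot> u"
      using cmp_assoc[OF e' d(1) p] cmp_assoc[OF e' d(1) q] d k sq by simp_all
    moreover have "q \<cdot> u \<in> hom C (Src C e) (Tgt C q)" "f \<cdot> (p \<cdot> u) = g \<cdot> (q \<cdot> u)"
      using cmp_hom[OF u q] cmp_assoc[OF u p f] cmp_assoc[OF u q g] com by simp_all
    \<comment> \<open>Both maps have the same composites with the two projections, so uniqueness for
      the pullback identifies them.\<close>
    ultimately have "d \<cdot> e = u" using uni[OF pu] u de by blast
    then show "d \<in> hom C (Tgt C e) (Src C q) \<and> d \<cdot> e = u \<and> q \<cdot> d = v" using d by simp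
  next
    fix l assume l: "l \<in> hom C (Tgt C e) (Src C q) \<and> l \<cdot> e = u \<and> q \<cdot> l = v"
    then have lh: "l \<in> hom C (Tgt C e) (Src C q)" by simp
    \<comment> \<open>Composing a competing diagonal with \<open>p\<close> solves the pasted
      problem, whose only solution is \<open>k\<close>.\<close>
    have "p \<cdot> l = k"
      by (rule k_uniq[OF cmp_hom[OF lh p]])
        (use cmp_assoc[OF e' lh p] cmp_assoc[OF lh p f] cmp_assoc[OF lh q g] com l in simp_all)
    then show "l = d" using d_uniq l by simp
  qed
qed

text \<open>This is the cancellation half of the pasting law: the right square and the outer
  rectangle are pullbacks, hence so is the left square. It will exhibit the map underlying
  \<open>n \<times> e\<close> as a pullback of \<open>e\<close>.\<close>

lemma pullback_paste_cancel:
  assumes pb: "is_pullback C f g p q" and pb': "is_pullback C f (g \<cdot> e) p' q'"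
    and e: "e \<in> hom C A (Src C g)"
    and h: "h \<in> hom C (Src C p') (Src C p)" "p \<cdot> h = p'" "q \<cdot> h = e \<cdot> q'"
  shows "is_pullback C e q q' h"
proof -
  have g: "g \<in> hom C (Src C g) (Tgt C f)" and f: "f \<in> hom C (Src C f) (Tgt C f)"
    and p: "p \<in> hom C (Src C p) (Src C f)" and q: "q \<in> hom C (Src C p) (Src C g)"
    and com: "f \<cdot> p = g \<cdot> q"
    using pb by (auto simp: is_pullback_def hom_def)
  have ge: "g \<cdot> e \<in> hom C A (Tgt C f)" using e g by (rule cmp_hom)
  then have p': "p' \<in> hom C (Src C p') (Src C f)" and q': "q' \<in> hom C (Src C p') A"
    using pb' by (auto simp: is_pullback_def hom_def)
  have uni: "\<exists>!u. u \<in> hom C Z (Src C p) \<and> p \<cdot> u = a \<and> q \<cdot> u = b"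
    if "a \<in> hom C Z (Src C f)" "b \<in> hom C Z (Src C g)" "f \<cdot> a = g \<cdot> b" for Z a b
    using pullback_universal[OF pb] that .
  have uni': "\<exists>!u. u \<in> hom C Z (Src C p') \<and> p' \<cdot> u = a \<and> q' \<cdot> u = b"
    if "a \<in> hom C Z (Src C f)" "b \<in> hom C Z A" "f \<cdot> a = (g \<cdot> e) \<cdot> b" for Z a b
    using pullback_universal[OF pb', of a Z b] that ge by (simp add: hom_def)
  have "\<exists>!u. u \<in> hom C Z (Src C p') \<and> q' \<cdot> u = a \<and> h \<cdot> u = b"
    if a: "a \<in> hom C Z A" and b: "b \<in> hom C Z (Src C p)" and ab: "e \<cdot> a = q \<cdot> b" for Z a b
  proof -
    have pb: "p \<cdot> b \<in> hom C Z (Src C f)" using b p by (rule cmp_hom)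
    \<comment> \<open>A cone over \<open>e\<close> and \<open>q\<close> yields a cone over the outer
      rectangle by composing its second leg with \<open>p\<close>.\<close>
    have "f \<cdot> (p \<cdot> b) = (g \<cdot> e) \<cdot> a"
      using cmp_assoc[OF b p f] cmp_assoc[OF b q g] cmp_assoc[OF a e g] com ab by simp
    from uni'[OF pb a this] obtain u where
      u: "u \<in> hom C Z (Src C p')" "p' \<cdot> u = p \<cdot> b" "q' \<cdot> u = a"
      and u_uniq: "\<And>w. w \<in> hom C Z (Src C p') \<Longrightarrow> p' \<cdot> w = p \<cdot> b \<Longrightarrow> q' \<cdot> w = a \<Longrightarrow> w = u"
      by metis
    show ?thesis
    proof (rule ex1I[of _ u])
      have hu: "h \<cdot> u \<in> hom C Z (Src C p)" using u(1) h(1) by (rule cmp_hom)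
      have "p \<cdot> (h \<cdot> u) = p \<cdot> b" using cmp_assoc[OF u(1) h(1) p] h(2) u by simp
      moreover have "q \<cdot> (h \<cdot> u) = q \<cdot> b"
        using cmp_assoc[OF u(1) h(1) q] cmp_assoc[OF u(1) q' e] h(3) u ab by simp
      moreover have "f \<cdot> (p \<cdot> b) = g \<cdot> (q \<cdot> b)"
        using cmp_assoc[OF b p f] cmp_assoc[OF b q g] com by simp
      ultimately have "h \<cdot> u = b" using uni[OF pb cmp_hom[OF b q]] hu b by blast
      then show "u \<in> hom C Z (Src C p') \<and> q' \<cdot> u = a \<and> h \<cdot> u = b" using u by simp
    next
      fix w assume w: "w \<in> hom C Z (Src C p') \<and> q' \<cdot> w = a \<and> h \<cdot> w = b"
      then show "w = u"
        using u_uniq[of w] cmp_assoc[of w Z "Src C p'" h "Src C p" p "Src C f"] h p by simp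
    qed
  qed
  then show ?thesis
    using is_pullbackI[OF e q q' h(1)] h(3) by simp
qed

text \<open>Since \<open>M\<close> consists of all maps right orthogonal to \<open>E\<close>, it
  suffices to lift \<open>x\<close> against each \<open>e\<close> in \<open>E\<close>. The two
  systems enter as variables with a single stability condition, so exchanging them gives the dual
  statement.\<close>

lemma exponential_in_right_class:
  assumes fs: "factorization_system C E M" and fs': "factorization_system C E' M'"
    and stable: "\<And>e n p q. e \<in> E \<Longrightarrow> n \<in> M' \<Longrightarrow> is_pullback C e n p q \<Longrightarrow> q \<in> E"
    and m: "m \<in> M" and n: "n \<in> M'"
    and exp: "is_exponential (slice C X) m n x"
  shows "x \<in> Obj (slice_of C M X)"
proof -
  let ?S = "slice C X"
  interpret S: category ?S by (rule category_slice)
  obtain F p q G where F: "is_product_functor ?S n F p q" and adj: "right_adjoint ?S ?S F G"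
    and x: "x = omap G m" and mo: "m \<in> Obj ?S"
    using exp unfolding is_exponential_def by blast
  have "x \<in> Obj ?S" using adj mo by (auto simp: x right_adjoint_def is_functor_def)
  then have xh: "x \<in> hom C (Src C x) X" and mh: "m \<in> hom C (Src C m) X"
    using mo by (auto simp: slice_def hom_def)
  have "orthogonal C e x" if "e \<in> E" for e
  proof -
    have eM: "e \<in> Mor C" using fs that unfolding factorization_system_def by blast
    then have eh: "e \<in> hom C (Src C e) (Tgt C e)" by (simp add: hom_def)
    have "bij_betw (\<lambda>d. d \<cdot>\<^bsub>?S\<^esub> (v \<cdot> e, e, v)) (hom ?S v x) (hom ?S (v \<cdot> e) x)"
      if v: "v \<in> hom C (Tgt C e) X" for v
    proof -
      \<comment> \<open>Each bottom edge \<open>v\<close> makes \<open>e\<close> a slice map with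
        target \<open>v\<close>, to which the product functor can be applied.\<close>
      let ?a = "(v \<cdot> e, e, v)"
      have ve: "v \<cdot> e \<in> hom C (Src C e) X" using eh v by (rule cmp_hom)
      have a: "?a \<in> hom ?S (v \<cdot> e) v"
        using v ve eh unfolding hom_slice by (auto simp: hom_def)
      have vo: "v \<in> Obj ?S" "v \<cdot> e \<in> Obj ?S" using v ve by (auto simp: slice_def hom_def)
      have pr: "is_product ?S n v (omap F v) (p v) (q v)"
        and pr': "is_product ?S n (v \<cdot> e) (omap F (v \<cdot> e)) (p (v \<cdot> e)) (q (v \<cdot> e))"
        using F vo by (auto simp: is_product_functor_def)
      have am: "?a \<in> Mor ?S" "Src ?S ?a = v \<cdot> e" "Tgt ?S ?a = v"
        using a unfolding hom_def by blast+
      have Fa: "mmap F ?a \<in> hom ?S (omap F (v \<cdot> e)) (omap F v)"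
        using F am by (auto simp: is_product_functor_def is_functor_def)
      \<comment> \<open>These equations identify \<open>mmap F ?a\<close> as
        \<open>n \<times> e\<close>. Read on underlying maps, they are the two commutativities
        needed for pasting.\<close>
      have Fpq: "p v \<cdot>\<^bsub>?S\<^esub> mmap F ?a = p (v \<cdot> e)" "q v \<cdot>\<^bsub>?S\<^esub> mmap F ?a = ?a \<cdot>\<^bsub>?S\<^esub> q (v \<cdot> e)"
        using F am unfolding is_product_functor_def by force+
      obtain p1 q1 where 1: "p v = (omap F v, p1, n)" "q v = (omap F v, q1, v)"
        "p1 \<in> hom C (Src C (omap F v)) (Src C n)" "q1 \<in> hom C (Src C (omap F v)) (Src C v)"
        "is_pullback C n v p1 q1"
        using pr by (rule slice_product_pullback)
      obtain p2 q2 where 2: "p (v \<cdot> e) = (omap F (v \<cdot> e), p2, n)"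
        "q (v \<cdot> e) = (omap F (v \<cdot> e), q2, v \<cdot> e)"
        "p2 \<in> hom C (Src C (omap F (v \<cdot> e))) (Src C n)" "is_pullback C n (v \<cdot> e) p2 q2"
        using pr' by (rule slice_product_pullback)
      obtain h where h: "mmap F ?a = (omap F (v \<cdot> e), h, omap F v)"
        "h \<in> hom C (Src C (omap F (v \<cdot> e))) (Src C (omap F v))"
        "omap F v \<cdot> h = omap F (v \<cdot> e)" "omap F v \<in> hom C (Src C (omap F v)) X"
        using Fa unfolding hom_slice by auto
      have "is_pullback C e q1 q2 h"
        using 1(5) 2(4)
      proof (rule pullback_paste_cancel)
        show "e \<in> hom C (Src C e) (Src C v)" using eh v by (simp add: hom_def)
        show "h \<in> hom C (Src C p2) (Src C p1)" using h(2) 1(3) 2(3) by (simp add: hom_def)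
        show "p1 \<cdot> h = p2" "q1 \<cdot> h = e \<cdot> q2" using Fpq unfolding 1 2 h Cmp_slice by auto
      qed
      \<comment> \<open>The projection \<open>q1\<close> is a pullback of \<open>n\<close> along
        \<open>v\<close>, so it inherits orthogonality to \<open>E'\<close> and lies in
        \<open>M'\<close>. Thus \<open>h\<close> is a pullback of a map in \<open>E\<close> along a
        map in \<open>M'\<close>.\<close>
      moreover have "q1 \<in> M'"
      proof -
        have "orthogonal C e' q1" if "e' \<in> E'" for e'
          using fs' n that pullback_orthogonal[OF 1(5), of e']
          unfolding factorization_system_def by blast
        then show ?thesis using fs' 1(4) unfolding factorization_system_def hom_def by blast
      qed
      ultimately have "h \<in> E" using stable \<open>e \<in> E\<close> by blast
      then have "orthogonal C h m" using fs m unfolding factorization_system_def by blast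
      \<comment> \<open>This is orthogonality of \<open>h\<close> and \<open>m\<close> at the bottom
        edge \<open>omap F v\<close>, where \<open>h\<close> regarded as a slice map is exactly
        \<open>mmap F ?a\<close>.\<close>
      then have "bij_betw (\<lambda>g. g \<cdot>\<^bsub>?S\<^esub> mmap F ?a) (hom ?S (omap F v) m) (hom ?S (omap F (v \<cdot> e)) m)"
        using orthogonal_iff_slice_bij[OF h(2) mh] h by force
      then show ?thesis
        unfolding x by (rule right_adjoint_precomp_bij[OF category_slice category_slice adj a mo])
    qed
    then show ?thesis using orthogonal_iff_slice_bij[OF eh xh] by blast
  qed
  then have "x \<in> M" using fs xh unfolding factorization_system_def hom_def by blast
  with \<open>x \<in> Obj ?S\<close> show ?thesis by (simp add: slice_of_def full_sub_def)
qed

end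

theorem proposition5p9:
  fixes C :: "('o, 'm) cat" and E M E' M' :: "'m set" and X :: 'o and m n :: 'm
  assumes "balanced_factorization_category C E M E' M'"
    and "\<And>Y k. Y \<in> Obj C \<Longrightarrow> k \<in> Obj (slice_of C M Y) \<Longrightarrow> exponentiable (slice C Y) k"
    and "\<And>Y k. Y \<in> Obj C \<Longrightarrow> k \<in> Obj (slice_of C M' Y) \<Longrightarrow> exponentiable (slice C Y) k"
    and "X \<in> Obj C"
    and "m \<in> Obj (slice_of C M X)"
    and "n \<in> Obj (slice_of C M' X)"
  shows "(\<forall>e. is_exponential (slice C X) m n e \<longrightarrow> e \<in> Obj (slice_of C M X)) \<and>
         (\<forall>e. is_exponential (slice C X) n m e \<longrightarrow> e \<in> Obj (slice_of C M' X))"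
proof -
  interpret balanced_factorization_category C E M E' M' by fact
  have mn: "m \<in> M" "n \<in> M'"
    using assms(5,6) by (auto simp: slice_of_def full_sub_def)
  show ?thesis
  proof (intro conjI allI impI)
    show "e \<in> Obj (slice_of C M X)" if "is_exponential (slice C X) m n e" for e
      using factorization factorization' _ mn that
      by (rule exponential_in_right_class) (rule pullback_E)
    show "e \<in> Obj (slice_of C M' X)" if "is_exponential (slice C X) n m e" for e
      using factorization' factorization _ mn(2,1) that
      by (rule exponential_in_right_class) (rule pullback_E')
  qed
qed

end
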